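(* Let $\lambda>-1/2$, $\lambda\ne0$, $C_n^\lambda$ the Gegenbauer polynomials, $M_n^\lambda(s)=\int_0^1 C_n^\lambda(x)x^{s-1}(1-x^2)^{\lambda/2-3/4}\,dx$, and $\varepsilon=(1-(-1)^n)/2$. Then \[ M_n^\lambda(s)=\frac{\Gamma\left(\frac\lambda2+\frac14\right)\Gamma\left(\frac{s+\varepsilon}{2}\right)}{2(n!)\,\Gamma\left(\frac{s+n+\lambda}{2}+\frac14\right)}\,p_n^\lambda(s) \] with $p_n^\lambda(s)$ a polynomial in $s$, and these polynomials satisfy, for every integer $n\ge0$, the difference equations \[ (s+2)(2\lambda+4n-2s-5)p_{2n}^\lambda(s+4)-(8\lambda n+2\lambda+8n^2-4s^2-12s-11)p_{2n}^\lambda(s+2)-(s+1)(2\lambda+4n+2s+1)p_{2n}^\lambda(s)=0, \] and \[ (s+3)(2\lambda+4n-2s-3)p_{2n+1}^\lambda(s+4)-(8\lambda n+6\lambda+8n^2+8n-4s^2-12s-9)p_{2n+1}^\lambda(s+2)-s(2\lambda+4n+2s+3)p_{2n+1}^\lambda(s)=0. \]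
   Context: $C_n^\lambda(x)=\sum_{r=0}^{\lfloor n/2\rfloor}(-1)^r\binom{n-r}{r}\binom{n-r-1+\lambda}{n-r}(2x)^{n-2r}$ (Gegenbauer polynomials). The integral defining $M_n^\lambda$ converges for $\Re s>0$ ($n$ even) or $\Re s>-1$ ($n$ odd) and is extended by analytic continuation. *)

theory Defs
  imports "HOL-Complex_Analysis.Complex_Analysis"
begin

definition gegenbauer :: "nat \<Rightarrow> real \<Rightarrow> real \<Rightarrow> real" where
  "gegenbauer n l x =
     (\<Sum>r\<le>n div 2. (-1) ^ r * real ((n - r) choose r) *
        ((real (n - r) - 1 + l) gchoose (n - r)) * (2 * x) ^ (n - 2 * r))"

definition parity_eps :: "nat \<Rightarrow> real" where
  "parity_eps n = (1 - (-1) ^ n) / 2"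

definition gegenbauer_mellin_integrand :: "nat \<Rightarrow> real \<Rightarrow> complex \<Rightarrow> real \<Rightarrow> complex" where
  "gegenbauer_mellin_integrand n l s x =
     of_real (gegenbauer n l x) * of_real x powr (s - 1) *
     of_real ((1 - x\<^sup>2) powr (l / 2 - 3 / 4))"

(* nicely_meromorphic_on fixes the value at every pole to be 0 and excludes removable
   singularities; hence a continuation of the integral from the half-plane to the
   whole plane is unique as a function. *)
definition is_gegenbauer_mellin_continuation ::
    "nat \<Rightarrow> real \<Rightarrow> (complex \<Rightarrow> complex) \<Rightarrow> bool" where
  "is_gegenbauer_mellin_continuation n l F \<longleftrightarrow>
     F nicely_meromorphic_on UNIV \<and>
     (\<forall>s. Re s > - parity_eps n \<longrightarrow>
        F s = integral {0..1} (gegenbauer_mellin_integrand n l s))"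

definition gegenbauer_mellin :: "nat \<Rightarrow> real \<Rightarrow> complex \<Rightarrow> complex" where
  "gegenbauer_mellin n l = (THE F. is_gegenbauer_mellin_continuation n l F)"

end

theory Submission
  imports Defs "HOL-Real_Asymp.Real_Asymp"
begin

text \<open>
  Expanding the Gegenbauer polynomial of degree $n = 2m + e$ in powers $x^{2k+e}$ turns the Mellin
  transform into a sum of Beta integrals. The complex Beta integral follows from the real one, since
  both sides are holomorphic in $s$. Pulling the common Gamma factors out of the sum, with
  $u = (s + e) / 2$ and $\beta = \lambda / 2 + 1 / 4$, leaves
  $\sum_k c_k (u)_k \prod_{k \le i < m} (u + \beta + i)$, a polynomial. Replacing $s$ by $s + 2$
  replaces $u$ by $u + 1$, so each difference equation is a three-term relation for
  a terminating hypergeometric sum and is proved by a telescoping (WZ) certificate.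
\<close>

section \<open>The real Beta integral in the variable x^2\<close>

lemma sq_image_Ioo_01: "(\<lambda>x::real. x\<^sup>2) ` {0<..<1} = {0<..<1}"
proof -
  have "y \<in> (\<lambda>x. x\<^sup>2) ` {0<..<1}" if "y \<in> {0<..<1}" for y :: real
    by (rule image_eqI[of _ _ "sqrt y"]) (use that in auto)
  moreover have "x\<^sup>2 \<in> {0<..<1}" if "x \<in> {0<..<1}" for x :: real
    using that by (auto simp: power_less_one_iff abs_square_less_1)
  ultimately show ?thesis by blast
qed

text \<open>Substitute t = x^2 in the integral for Beta(a/2, b): the Jacobian 2x combines with
  x^(a-2) to give 2 x^(a-1), whence the factor 1/2.\<close>

lemma has_integral_Beta_squares_real:
  fixes a b :: real
  assumes "a > 0" "b > 0"
  shows "((\<lambda>x. x powr (a - 1) * (1 - x\<^sup>2) powr (b - 1)) has_integral Beta (a / 2) b / 2) {0<..<1}"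
proof -
  define f where "f = (\<lambda>t::real. t powr (a / 2 - 1) * (1 - t) powr (b - 1))"
  have f: "(f has_integral Beta (a / 2) b) {0<..<1}"
    using has_integral_Beta_real[of "a / 2" b] assms
    by (simp add: f_def has_integral_Icc_iff_Ioo)
  \<comment> \<open>The change of variables theorem is about absolutely integrable functions;
    nonnegativity upgrades plain integrability.\<close>
  have "f absolutely_integrable_on {0<..<1}"
    by (rule nonnegative_absolutely_integrable_1) (use f in \<open>auto simp: f_def has_integral_iff\<close>)
  hence "(\<lambda>x. \<bar>2 * x\<bar> * f (x\<^sup>2)) absolutely_integrable_on {0<..<1} \<and>
         integral {0<..<1} (\<lambda>x. \<bar>2 * x\<bar> * f (x\<^sup>2)) = Beta (a / 2) b"
    using f
    by (subst has_absolute_integral_change_of_variables_1')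
       (auto simp: sq_image_Ioo_01 has_integral_iff inj_on_def power2_eq_iff
             intro!: derivative_eq_intros)
  hence "((\<lambda>x. \<bar>2 * x\<bar> * f (x\<^sup>2)) has_integral Beta (a / 2) b) {0<..<1}"
    by (simp add: has_integral_iff set_lebesgue_integral_eq_integral)
  hence "((\<lambda>x. (1 / 2) * (\<bar>2 * x\<bar> * f (x\<^sup>2))) has_integral (1 / 2) * Beta (a / 2) b) {0<..<1}"
    by (rule has_integral_mult_right)
  also have "?this \<longleftrightarrow> ?thesis"
  proof (subst has_integral_cong)
    fix x :: real assume x: "x \<in> {0<..<1}"
    have "(x\<^sup>2) powr (a / 2 - 1) = x powr (2 * (a / 2 - 1))"
      using x by (simp add: powr_powr flip: powr_numeral)
    moreover have "x * x powr (a - 2) = x powr (a - 1)"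
      using x powr_mult_base[of x "a - 2"] by simp
    ultimately show "(1 / 2) * (\<bar>2 * x\<bar> * f (x\<^sup>2)) = x powr (a - 1) * (1 - x\<^sup>2) powr (b - 1)"
      using x by (simp add: f_def algebra_simps)
  qed simp
  finally show ?thesis .
qed

section \<open>Holomorphy of Mellin transforms over the unit interval\<close>

text \<open>For x > 0 the modulus of x^(s-1) is x^(Re s - 1), so the real integrand at Re s
  dominates.\<close>

lemma mellin_absolutely_integrable:
  fixes w :: "real \<Rightarrow> real"
  assumes cont: "continuous_on {0<..<1} w"
    and nonneg: "\<And>x. x \<in> {0<..<1} \<Longrightarrow> w x \<ge> 0"
    and int: "(\<lambda>x. x powr (Re s - 1) * w x) integrable_on {0<..<1}"
  shows "(\<lambda>x. of_real x powr (s - 1) * of_real (w x)) absolutely_integrable_on {0<..<1}"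
proof (rule measurable_bounded_by_integrable_imp_absolutely_integrable[OF _ _ int])
  show "(\<lambda>x. of_real x powr (s - 1) * of_real (w x)) \<in> borel_measurable (lebesgue_on {0<..<1})"
    by (intro continuous_imp_measurable_on_sets_lebesgue continuous_intros cont) auto
qed (use nonneg in \<open>auto simp: norm_mult norm_powr_real_powr\<close>)

text \<open>Integrals over compact subintervals of (0,1) are holomorphic by differentiation under
  the integral sign. They converge locally uniformly to the full integral, because near a given
  point a single integrable function dominates the integrand for all s.\<close>

lemma mellin_holomorphic:
  fixes w :: "real \<Rightarrow> real"
  assumes cont: "continuous_on {0<..<1} w"
    and nonneg: "\<And>x. x \<in> {0<..<1} \<Longrightarrow> w x \<ge> 0"
    and int: "\<And>\<sigma>. \<sigma> > 0 \<Longrightarrow> (\<lambda>x. x powr (\<sigma> - 1) * w x) integrable_on {0<..<1}"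
  shows "(\<lambda>s. integral {0<..<1} (\<lambda>x. of_real x powr (s - 1) * of_real (w x)))
           holomorphic_on {s. Re s > 0}"
proof -
  \<comment> \<open>These intervals exhaust (0,1) and avoid both endpoints, where the integrand may
    be singular.\<close>
  define lo hi :: "nat \<Rightarrow> real" where "lo = (\<lambda>n. 1 / real (n + 2))" and "hi = (\<lambda>n. 1 - 1 / real (n + 2))"
  define I where "I = (\<lambda>n. cbox (lo n) (hi n))"
  have lo_hi: "lo n > 0" "hi n < 1" for n
    by (simp_all add: lo_def hi_def)
  have I_sub: "I n \<subseteq> {0<..<1}" for n
    using lo_hi[of n] by (auto simp: I_def)
  define f :: "complex \<Rightarrow> real \<Rightarrow> complex"
    where "f = (\<lambda>s x. of_real x powr (s - 1) * of_real (w x))"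
  have f_int: "f s integrable_on {0<..<1}" if "Re s > 0" for s
    unfolding f_def using mellin_absolutely_integrable[OF cont nonneg int[OF that]]
      set_lebesgue_integral_eq_integral(1) by blast
  have f_int': "f s integrable_on I n" if "Re s > 0" for s n
    unfolding I_def by (rule integrable_on_subcbox[OF f_int[OF that]]) (use I_sub[of n] I_def in auto)
  have "(\<lambda>s. integral {0<..<1} (f s)) holomorphic_on {s. Re s > 0}"
  proof (rule holomorphic_uniform_sequence[where f = "\<lambda>n s. integral (I n) (f s)"])
    show "open {s. Re s > 0}" by (rule open_halfspace_Re_gt)
    show "(\<lambda>s. integral (I n) (f s)) holomorphic_on {s. Re s > 0}" for n
      unfolding I_def
    proof (rule leibniz_rule_holomorphic)
      fix s :: complex and x :: real
      assume "x \<in> cbox (lo n) (hi n)"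
      hence "x > 0" using I_sub[of n] by (auto simp: I_def)
      thus "((\<lambda>s. f s x) has_field_derivative
               of_real (ln x) * of_real x powr (s - 1) * of_real (w x)) (at s within {s. Re s > 0})"
        unfolding f_def by (auto intro!: derivative_eq_intros simp: powr_def Ln_of_real)
    next
      have "continuous_on ({s. Re s > 0} \<times> I n) (\<lambda>p. w (snd p))"
        by (rule continuous_on_compose2[OF cont continuous_on_snd[OF continuous_on_id]])
           (use I_sub[of n] in auto)
      thus "continuous_on ({s. Re s > 0} \<times> cbox (lo n) (hi n))
              (\<lambda>(s, x). of_real (ln x) * of_real x powr (s - 1) * of_real (w x))"
        unfolding case_prod_beta I_def
        by (intro continuous_intros) (use lo_hi[of n] in auto)
    qed (use f_int' in \<open>auto simp: I_def convex_halfspace_Re_gt\<close>)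
  next
    fix s0 :: complex assume s0: "s0 \<in> {s. Re s > 0}"
    \<comment> \<open>With half of Re s0 as radius, the closed ball around s0 stays in Re s \<ge>
      \<sigma> > 0, so \<open>W\<close> below dominates on the whole ball.\<close>
    define \<sigma> where "\<sigma> = Re s0 / 2"
    have \<sigma>: "\<sigma> > 0" using s0 by (simp add: \<sigma>_def)
    have ball: "Re s \<ge> \<sigma>" if "s \<in> cball s0 \<sigma>" for s
      using that abs_Re_le_cmod[of "s0 - s"] by (auto simp: \<sigma>_def dist_norm)
    define W where "W = (\<lambda>x. x powr (\<sigma> - 1) * w x)"
    have W_int: "W integrable_on {0<..<1}" unfolding W_def by (rule int[OF \<sigma>])
    have W_int': "(\<lambda>x. if x \<in> I n then W x else 0) integrable_on {0<..<1}" for n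
      unfolding integrable_restrict_Int
      using integrable_on_subcbox[OF W_int] I_sub[of n] by (simp add: I_def Int_absorb2)
    have lim: "(\<lambda>n. integral {0<..<1} (\<lambda>x. if x \<in> I n then W x else 0)) \<longlonglongrightarrow> integral {0<..<1} W"
    proof (rule dominated_convergence(2)[OF W_int' W_int])
      show "norm (if x \<in> I n then W x else 0) \<le> W x" if "x \<in> {0<..<1}" for n x
        using nonneg[OF that] by (auto simp: W_def)
      fix x :: real assume x: "x \<in> {0<..<1}"
      have "(\<lambda>n. 1 / real (n + 2)) \<longlonglongrightarrow> 0" by real_asymp
      hence "eventually (\<lambda>n. 1 / real (n + 2) < min x (1 - x)) sequentially"
        using x by (intro order_tendstoD) auto
      hence "eventually (\<lambda>n. (if x \<in> I n then W x else 0) = W x) sequentially"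
        by eventually_elim (auto simp: I_def lo_def hi_def)
      thus "(\<lambda>n. if x \<in> I n then W x else 0) \<longlonglongrightarrow> W x"
        by (rule tendsto_eventually)
    qed
    have "uniform_limit (cball s0 \<sigma>) (\<lambda>n s. integral (I n) (f s))
            (\<lambda>s. integral {0<..<1} (f s)) sequentially"
    proof (rule uniform_limitI)
      fix e :: real assume "e > 0"
      with lim have "eventually (\<lambda>n. dist (integral {0<..<1} (\<lambda>x. if x \<in> I n then W x else 0))
                               (integral {0<..<1} W) < e) sequentially"
        by (rule tendstoD)
      thus "eventually (\<lambda>n. \<forall>s\<in>cball s0 \<sigma>. dist (integral (I n) (f s)) (integral {0<..<1} (f s)) < e)
              sequentially"
      proof eventually_elim
        case (elim n)
        show ?case
        proof
          fix s assume s: "s \<in> cball s0 \<sigma>"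
          have s_pos: "Re s > 0" using ball[OF s] \<sigma> by simp
          have fi: "(\<lambda>x. if x \<in> I n then f s x else 0) integrable_on {0<..<1}"
            unfolding integrable_restrict_Int
            using f_int'[OF s_pos, of n] I_sub[of n] by (simp add: Int_absorb2)
          have "integral (I n) (f s) = integral {0<..<1} (\<lambda>x. if x \<in> I n then f s x else 0)"
            using I_sub[of n]
            by (simp add: Int_absorb2 Henstock_Kurzweil_Integration.integral_restrict_Int)
          hence "norm (integral {0<..<1} (f s) - integral (I n) (f s)) =
                 norm (integral {0<..<1} (\<lambda>x. f s x - (if x \<in> I n then f s x else 0)))"
            by (simp add: Henstock_Kurzweil_Integration.integral_diff f_int[OF s_pos] fi)
          \<comment> \<open>The part of the integral outside \<open>I n\<close> is bounded by that
            of \<open>W\<close>, since x^(Re s - 1) \<le> x^(\<sigma> - 1) for 0 < x < 1. This bound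
            does not involve s, which makes the convergence uniform.\<close>
          also have "\<dots> \<le> integral {0<..<1} (\<lambda>x. W x - (if x \<in> I n then W x else 0))"
          proof (rule Henstock_Kurzweil_Integration.integral_norm_bound_integral)
            fix x :: real assume x: "x \<in> {0<..<1}"
            have "x powr (Re s - 1) \<le> x powr (\<sigma> - 1)"
              using x ball[OF s] by (intro powr_mono') auto
            thus "norm (f s x - (if x \<in> I n then f s x else 0)) \<le> W x - (if x \<in> I n then W x else 0)"
              using x nonneg[OF x]
              by (auto simp: f_def W_def norm_mult norm_powr_real_powr intro: mult_right_mono)
          qed (intro integrable_diff f_int fi W_int W_int' s_pos)+
          also have "\<dots> = integral {0<..<1} W - integral {0<..<1} (\<lambda>x. if x \<in> I n then W x else 0)"
            by (intro Henstock_Kurzweil_Integration.integral_diff W_int W_int')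
          also have "\<dots> < e" using elim by (auto simp: dist_norm)
          finally show "dist (integral (I n) (f s)) (integral {0<..<1} (f s)) < e"
            by (simp add: dist_norm norm_minus_commute)
        qed
      qed
    qed
    thus "\<exists>d>0. cball s0 d \<subseteq> {s. Re s > 0} \<and>
            uniform_limit (cball s0 d) (\<lambda>n s. integral (I n) (f s)) (\<lambda>s. integral {0<..<1} (f s))
              sequentially"
      using \<sigma> ball by (intro exI[of _ \<sigma>]) force
  qed
  thus ?thesis by (simp only: f_def)
qed

section \<open>The complex Beta integral\<close>

text \<open>Identity theorem on the right half-plane: both sides are holomorphic in s and agree on
  the positive reals, which accumulate at 1.\<close>

lemma has_integral_Beta_squares:
  fixes s :: complex and b :: real
  assumes s: "Re s > 0" and b: "b > 0"
  shows "((\<lambda>x. of_real x powr (s - 1) * of_real ((1 - x\<^sup>2) powr (b - 1)))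
            has_integral Beta (s / 2) (of_real b) / 2) {0<..<1}"
proof -
  define w where "w = (\<lambda>x::real. (1 - x\<^sup>2) powr (b - 1))"
  define f where "f = (\<lambda>s::complex. \<lambda>x. of_real x powr (s - 1) * complex_of_real (w x))"
  have cont: "continuous_on {0<..<1} w"
    unfolding w_def by (intro continuous_intros) (auto simp: power2_eq_1_iff)
  have real: "((\<lambda>x. x powr (\<sigma> - 1) * w x) has_integral Beta (\<sigma> / 2) b / 2) {0<..<1}"
    if "\<sigma> > 0" for \<sigma>
    unfolding w_def using that b by (rule has_integral_Beta_squares_real)
  have int: "(\<lambda>x. x powr (\<sigma> - 1) * w x) integrable_on {0<..<1}" if "\<sigma> > 0" for \<sigma>
    using real[OF that] by blast
  have "integral {0<..<1} (f s) - Beta (s / 2) (of_real b) / 2 = 0"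
  proof (rule analytic_continuation[where S = "{s. Re s > 0}" and U = "complex_of_real ` {0<..}" and \<xi> = 1 and
        f = "\<lambda>s. integral {0<..<1} (f s) - Beta (s / 2) (of_real b) / 2"])
    have not_nonpos: "z \<notin> \<int>\<^sub>\<le>\<^sub>0" if "Re z > 0" for z :: complex
      using that by (auto elim!: nonpos_Ints_cases)
    have "(\<lambda>s. integral {0<..<1} (f s)) holomorphic_on {s. Re s > 0}"
      unfolding f_def by (rule mellin_holomorphic[OF cont _ int]) (auto simp: w_def)
    thus "(\<lambda>s. integral {0<..<1} (f s) - Beta (s / 2) (of_real b) / 2) holomorphic_on {s. Re s > 0}"
      using b by (intro holomorphic_intros) (auto intro!: not_nonpos)
    show "open {s. Re s > 0}" "connected {s. Re s > 0}"
      by (auto simp: open_halfspace_Re_gt convex_halfspace_Re_gt convex_connected)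
    show "(1 :: complex) islimpt of_real ` {0<..}"
      unfolding islimpt_sequential
    proof (intro exI conjI allI)
      show "complex_of_real (1 + inverse (real (Suc n))) \<in> of_real ` {0<..} - {1}" for n
        by (auto simp: add_pos_pos simp flip: of_real_add of_real_inverse)
      have "(\<lambda>n. complex_of_real (1 + inverse (real (Suc n)))) \<longlonglongrightarrow> of_real (1 + 0)"
        by (intro tendsto_intros LIMSEQ_inverse_real_of_nat)
      thus "(\<lambda>n. complex_of_real (1 + inverse (real (Suc n)))) \<longlonglongrightarrow> 1"
        by simp
    qed
  next
    fix z :: complex assume "z \<in> of_real ` {0<..}"
    then obtain \<sigma> where \<sigma>: "\<sigma> > 0" "z = of_real \<sigma>" by auto
    have "((\<lambda>x. complex_of_real (x powr (\<sigma> - 1) * w x)) has_integral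
             complex_of_real (Beta (\<sigma> / 2) b / 2)) {0<..<1}"
      using real[OF \<sigma>(1)] by (rule has_integral_of_real)
    also have "?this \<longleftrightarrow> (f z has_integral complex_of_real (Beta (\<sigma> / 2) b / 2)) {0<..<1}"
      by (intro has_integral_cong) (auto simp: f_def \<sigma> powr_of_real[symmetric])
    finally show "integral {0<..<1} (f z) - Beta (z / 2) (of_real b) / 2 = 0"
      using Beta_complex_of_real[of "\<sigma> / 2" b] by (simp add: \<sigma>(2) integral_unique)
  qed (use s in auto)
  moreover have "f s integrable_on {0<..<1}"
    unfolding f_def using mellin_absolutely_integrable[OF cont _ int[OF s]] 
      set_lebesgue_integral_eq_integral(1) by (auto simp: w_def)
  ultimately show ?thesis
    unfolding f_def w_def by (simp add: has_integral_iff)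
qed

section \<open>Uniqueness of nicely meromorphic functions\<close>

text \<open>The difference, with its singularities removed, vanishes on the connected set A, so F
  and G agree on a punctured neighbourhood of each point. The values at the point itself then agree
  too: at a common pole both are 0, and elsewhere both are the common limit.\<close>

lemma nicely_meromorphic_eqI:
  assumes F: "F nicely_meromorphic_on A" and G: "G nicely_meromorphic_on A"
    and A: "open A" "connected A" "z0 \<in> A"
    and freq: "frequently (\<lambda>z. F z = G z) (at z0)" and z: "z \<in> A"
  shows "F z = G z"
proof -
  define D where "D = (\<lambda>z. F z - G z)"
  have D: "D meromorphic_on A"
    using F G unfolding D_def by (intro meromorphic_intros) (auto simp: nicely_meromorphic_on_def)
  have ev: "eventually (\<lambda>w. remove_sings D w = D w) (at x)" if "x \<in> A" for x
    using D that A(1) eventually_remove_sings_eq_at meromorphic_on_isolated_singularity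
      meromorphic_on_meromorphic_at by blast
  have "frequently (\<lambda>z. remove_sings D z = 0) (at z0)"
    using frequently_eventually_conj[OF freq ev[OF A(3)]]
    by (rule frequently_elim1) (auto simp: D_def)
  hence zero: "remove_sings D w = 0" if "w \<in> A" for w
    using frequently_eq_meromorphic_imp_constant[OF _ remove_sings_nicely_meromorphic[OF D] A(1,2,3)]
      that by blast
  have "eventually (\<lambda>w. w \<in> A) (at z)"
    using A(1) z eventually_at_in_open' by blast
  with ev[OF z] have eq: "eventually (\<lambda>w. F w = G w) (at z)"
    by eventually_elim (metis D_def eq_iff_diff_eq_0 zero)
  have pole: "is_pole F z \<longleftrightarrow> is_pole G z"
    by (rule is_pole_cong[OF eq refl])
  show ?thesis
  proof (cases "is_pole F z")
    case True
    \<comment> \<open>A nicely meromorphic function either has a pole with value 0 or tends to its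
      value; at a pole the second is impossible.\<close>
    have "H z = 0" if "H nicely_meromorphic_on A" "is_pole H z" for H
      using that z at_neq_bot not_tendsto_and_filterlim_at_infinity
      unfolding nicely_meromorphic_on_def is_pole_def by blast
    with True F G pole show ?thesis by metis
  next
    case False
    hence "F \<midarrow>z\<rightarrow> F z" "G \<midarrow>z\<rightarrow> G z"
      using F G z pole unfolding nicely_meromorphic_on_def by blast+
    moreover have "G \<midarrow>z\<rightarrow> F z"
      using \<open>F \<midarrow>z\<rightarrow> F z\<close> tendsto_cong[OF eq] by blast
    ultimately show ?thesis using LIM_unique by blast
  qed
qed

section \<open>Coefficients of the Gegenbauer polynomials\<close>

text \<open>The coefficient of \<open>x ^ (2 * k + e)\<close> in degree \<open>2 * m + e\<close>,
  for e \<le> 1. It is the term r = m - k of the defining sum.\<close>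

definition gegenbauer_coeff :: "nat \<Rightarrow> nat \<Rightarrow> real \<Rightarrow> nat \<Rightarrow> real" where
  "gegenbauer_coeff m e l k =
     (-1) ^ (m - k) * pochhammer l (m + e + k) / (fact (m - k) * fact (2 * k + e)) * 2 ^ (2 * k + e)"

text \<open>Reverse the sum by r = m - k. The factorial of m + e + k in the numerator of the first
  binomial cancels the denominator of the second.\<close>

lemma gegenbauer_conv_coeff:
  assumes "e \<le> 1"
  shows "gegenbauer (2 * m + e) l x = (\<Sum>k\<le>m. gegenbauer_coeff m e l k * x ^ (2 * k + e))"
proof -
  have m: "(2 * m + e) div 2 = m" using assms by simp
  have "gegenbauer (2 * m + e) l x =
     (\<Sum>r\<le>m. (-1) ^ r * real ((2 * m + e - r) choose r) *
        ((real (2 * m + e - r) - 1 + l) gchoose (2 * m + e - r)) * (2 * x) ^ (2 * m + e - 2 * r))"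
    unfolding gegenbauer_def m ..
  also have "\<dots> = (\<Sum>k\<le>m. (-1) ^ (m - k) * real ((2 * m + e - (m - k)) choose (m - k)) *
        ((real (2 * m + e - (m - k)) - 1 + l) gchoose (2 * m + e - (m - k))) *
        (2 * x) ^ (2 * m + e - 2 * (m - k)))"
    by (rule sum.reindex_bij_witness[of _ "\<lambda>k. m - k" "\<lambda>k. m - k"]) auto
  also have "\<dots> = (\<Sum>k\<le>m. gegenbauer_coeff m e l k * x ^ (2 * k + e))"
  proof (rule sum.cong)
    fix k assume "k \<in> {..m}"
    hence k: "k \<le> m" by simp
    have idx: "2 * m + e - (m - k) = m + e + k" "2 * m + e - 2 * (m - k) = 2 * k + e"
      using k by auto
    have "(m + e + k) choose (m - k) = fact (m + e + k) / (fact (m - k) * fact (2 * k + e) :: real)"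
      using k by (subst binomial_fact) (auto simp: algebra_simps mult_2 intro!: arg_cong[where f = fact])
    moreover have "(real (m + e + k) - 1 + l) gchoose (m + e + k) =
                   pochhammer l (m + e + k) / fact (m + e + k)"
      by (simp add: gbinomial_pochhammer')
    ultimately show "(-1) ^ (m - k) * real ((2 * m + e - (m - k)) choose (m - k)) *
        ((real (2 * m + e - (m - k)) - 1 + l) gchoose (2 * m + e - (m - k))) *
        (2 * x) ^ (2 * m + e - 2 * (m - k)) = gegenbauer_coeff m e l k * x ^ (2 * k + e)"
      unfolding idx by (simp add: gegenbauer_coeff_def power_mult_distrib)
  qed simp
  finally show ?thesis .
qed

text \<open>The factorials contribute (2k+1+e)(2k+2+e) to the ratio of neighbours. For e = 0 and e =
  1 this equals 2(k+1)(2k+1+2e), which gives both parities one common form.\<close>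

lemma gegenbauer_coeff_Suc:
  assumes "e \<le> 1" "k < m"
  shows "gegenbauer_coeff m e l (Suc k) * (real (Suc k) * (2 * real k + 1 + 2 * real e)) =
         - 2 * (l + real m + real e + real k) * (real m - real k) * gegenbauer_coeff m e l k"
proof -
  obtain j where m: "m = Suc (k + j)"
    using assms(2) less_imp_Suc_add by auto
  define p where "p = pochhammer l (Suc (k + j) + e + k)"
  have p: "pochhammer l (Suc (k + j) + e + Suc k) = p * (l + real (Suc (k + j) + e + k))"
    by (simp add: p_def pochhammer_Suc)
  have "e = 0 \<or> e = 1" using assms(1) by auto
  thus ?thesis
    unfolding gegenbauer_coeff_def m p p_def[symmetric]
    by (elim disjE; simp add: Suc_diff_le divide_simps del: of_nat_Suc; simp add: algebra_simps)
qed

section \<open>The terminating sum and its telescoping recurrence\<close>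

text \<open>The Pochhammer factor stands for Gamma(u+k)/Gamma(u) and the product for
  Gamma(u+\<beta>+m)/Gamma(u+\<beta>+k); in this form each term is a polynomial in u.\<close>

definition mellin_summand :: "nat \<Rightarrow> (nat \<Rightarrow> complex) \<Rightarrow> complex \<Rightarrow> nat \<Rightarrow> complex \<Rightarrow> complex" where
  "mellin_summand m c \<beta> k u = c k * pochhammer u k * (\<Prod>i=k..<m. u + \<beta> + of_nat i)"

text \<open>Replacing u by u + 1 slides both products one step: each gains a factor at the top and
  loses one at the bottom.\<close>

lemma mellin_summand_shift:
  assumes "k \<le> m" "u \<noteq> 0" "u + \<beta> + of_nat k \<noteq> 0"
  shows "mellin_summand m c \<beta> k (u + 1) =
         mellin_summand m c \<beta> k u * ((u + of_nat k) / u) * ((u + \<beta> + of_nat m) / (u + \<beta> + of_nat k))"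
proof -
  have poch: "pochhammer (u + 1) k = pochhammer u k * (u + of_nat k) / u"
    using assms(2) pochhammer_rec[of u k] pochhammer_Suc[of u k] by (simp add: field_simps)
  have "(\<Prod>i=k..<m. u + 1 + \<beta> + of_nat i) = (\<Prod>i=Suc k..<Suc m. u + \<beta> + of_nat i)"
    by (subst prod.shift_bounds_Suc_ivl) (simp add: algebra_simps)
  moreover have "(u + \<beta> + of_nat k) * (\<Prod>i=Suc k..<Suc m. u + \<beta> + of_nat i) =
                 (\<Prod>i=k..<Suc m. u + \<beta> + of_nat i)"
    using assms(1) by (subst (2) prod.atLeast_Suc_lessThan) auto
  moreover have "(\<Prod>i=k..<Suc m. u + \<beta> + of_nat i) =
                 (\<Prod>i=k..<m. u + \<beta> + of_nat i) * (u + \<beta> + of_nat m)"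
    using assms(1) by simp
  ultimately have "(\<Prod>i=k..<m. u + 1 + \<beta> + of_nat i) =
      (\<Prod>i=k..<m. u + \<beta> + of_nat i) * (u + \<beta> + of_nat m) / (u + \<beta> + of_nat k)"
    using assms(3) by (simp add: field_simps)
  thus ?thesis
    unfolding mellin_summand_def poch by simp
qed

text \<open>Passing to k + 1 adds the factor u + k to the Pochhammer symbol and drops u + \<beta> +
  k from the product. The coefficient ratio y / x is kept in cross-multiplied form.\<close>

lemma mellin_summand_Suc:
  assumes "k < m" "u + \<beta> + of_nat k \<noteq> 0"
    and "c (Suc k) * x = c k * y"
  shows "mellin_summand m c \<beta> (Suc k) u * x =
         mellin_summand m c \<beta> k u * y * (u + of_nat k) / (u + \<beta> + of_nat k)"
proof -
  have "(\<Prod>i=k..<m. u + \<beta> + of_nat i) = (u + \<beta> + of_nat k) * (\<Prod>i=Suc k..<m. u + \<beta> + of_nat i)"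
    using assms(1) by (rule prod.atLeast_Suc_lessThan)
  hence "mellin_summand m c \<beta> k u * y * (u + of_nat k) / (u + \<beta> + of_nat k) =
         (c k * y) * (pochhammer u k * (u + of_nat k)) * (\<Prod>i=Suc k..<m. u + \<beta> + of_nat i)"
    using assms(2) by (simp add: mellin_summand_def)
  thus ?thesis
    unfolding assms(3)[symmetric] by (simp add: mellin_summand_def pochhammer_Suc)
qed

text \<open>The polynomial identity left of the telescoping relation once the common factor of all
  terms is divided out and denominators are cleared.\<close>

lemma mellin_certificate:
  fixes u \<beta> k m e l b A B :: complex
  assumes "e = 0 \<or> e = 1" and "l = 2 * \<beta> - 1 / 2" and "b = u + \<beta>"
    and "A = 2 * l + 4 * m - 4 * u - 5 + 4 * e"
    and "B = - (8 * l * m + 2 * l + 8 * m\<^sup>2 - 16 * u\<^sup>2 - 24 * u - 11 + e * (4 * l + 8 * m + 16 * u + 10))"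
  shows "2 * A * (b + m + 1) * (u + k) * (u + k + 1) + B * (u + k) * (b + k + 1)
           - 4 * u * (2 * u + 1 - 2 * e) * (b + k) * (b + k + 1) =
         4 * \<beta> * (- 2 * (l + m + e + k) * (m - k) * (u + k) - k * (2 * k - 1 + 2 * e) * (b + k + 1))"
  using assms(1)
proof
  assume "e = 0"
  thus ?thesis unfolding assms(2-) by (simp add: field_simps power2_eq_square)
next
  assume "e = 1"
  thus ?thesis unfolding assms(2-) by (simp add: field_simps power2_eq_square)
qed

text \<open>
  The certificate is $G_k = \frac{4 \beta (u + \beta + m)}{u (u + \beta + k)}\, k (2k - 1 + 2e)\, T_k(u)$.
  In the proof, \<open>H k\<close> is $G_{k+1}$ rewritten as a multiple of $T_k(u)$; it carries
  the factor $m - k$, so the sum vanishes.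
\<close>

lemma mellin_summand_telescope:
  fixes c :: "nat \<Rightarrow> complex" and \<beta> u l :: complex and m e :: nat
  assumes e: "e = 0 \<or> e = 1" and l: "l = 2 * \<beta> - 1 / 2"
    and c: "\<And>k. k < m \<Longrightarrow> c (Suc k) * (of_nat (Suc k) * (2 * of_nat k + 1 + 2 * of_nat e)) =
                c k * (- 2 * (l + of_nat m + of_nat e + of_nat k) * (of_nat m - of_nat k))"
    and u: "\<And>k. u + of_nat k \<noteq> 0" and b: "\<And>k. u + \<beta> + of_nat k \<noteq> 0"
  defines "S \<equiv> (\<lambda>u. \<Sum>k\<le>m. mellin_summand m c \<beta> k u)"
    and "A \<equiv> 2 * l + 4 * of_nat m - 4 * u - 5 + 4 * of_nat e"
    and "B \<equiv> - (8 * l * of_nat m + 2 * l + 8 * (of_nat m)\<^sup>2 - 16 * u\<^sup>2 - 24 * u - 11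
                 + of_nat e * (4 * l + 8 * of_nat m + 16 * u + 10))"
    and "C \<equiv> 4 * (2 * u + 1 - 2 * of_nat e) * (u + \<beta> + of_nat m)"
  shows "2 * (u + 1) * A * S (u + 2) + B * S (u + 1) - C * S u = 0"
proof -
  define T where "T = (\<lambda>k. mellin_summand m c \<beta> k)"
  define E where "E = (\<lambda>k. 2 * (u + 1) * A * T k (u + 2) + B * T k (u + 1) - C * T k u)"
  define Y where "Y = u + \<beta> + of_nat m"
  define q where "q = (\<lambda>k::nat. - 2 * (l + of_nat m + of_nat e + of_nat k) * (of_nat m - of_nat k))"
  define r :: "nat \<Rightarrow> complex" where "r = (\<lambda>k::nat. of_nat k * (2 * of_nat k - 1 + 2 * of_nat e))"
  define G where "G = (\<lambda>k. 4 * \<beta> / u * Y * (T k u * r k) / (u + \<beta> + of_nat k))"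
  define H where "H = (\<lambda>k. 4 * \<beta> / u * Y * (T k u * q k * (u + of_nat k) / (u + \<beta> + of_nat k))
                        / (u + \<beta> + of_nat (Suc k)))"
  have u0: "u \<noteq> 0" and u1: "u + 1 \<noteq> 0"
    using u[of 0] u[of 1] by simp_all
  have E: "E k = H k - G k" if k: "k \<le> m" for k
  proof -
    define X Z where "X = u + of_nat k" and "Z = u + \<beta> + of_nat k"
    have Z0: "Z \<noteq> 0" "Z + 1 \<noteq> 0"
      using b[of k] b[of "Suc k"] by (simp_all add: Z_def algebra_simps)
    have T1: "T k (u + 1) = T k u * (X / u) * (Y / Z)"
      unfolding T_def X_def Y_def Z_def using k u0 b[of k] by (rule mellin_summand_shift)
    have "T k (u + 2) = T k (u + 1) * ((X + 1) / (u + 1)) * ((Y + 1) / (Z + 1))"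
      using mellin_summand_shift[of k m "u + 1" \<beta> c] k u1 Z0(2)
      by (simp add: T_def X_def Y_def Z_def algebra_simps)
    hence T2: "T k (u + 2) = T k u * (X / u) * (Y / Z) * ((X + 1) / (u + 1)) * ((Y + 1) / (Z + 1))"
      by (simp only: T1)
    \<comment> \<open>The two shift formulas express everything through \<open>T k u\<close>;
      pulling out the common rational factor leaves the left-hand side of
      \<open>mellin_certificate\<close>.\<close>
    have "E k = T k u * Y / (u * Z * (Z + 1)) *
            (2 * A * (Y + 1) * X * (X + 1) + B * X * (Z + 1)
             - 4 * u * (2 * u + 1 - 2 * of_nat e) * Z * (Z + 1))"
      unfolding E_def T1 T2 C_def Y_def[symmetric] using u0 u1 Z0
      by (simp add: divide_simps) (simp add: algebra_simps)
    also have "2 * A * (Y + 1) * X * (X + 1) + B * X * (Z + 1)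
             - 4 * u * (2 * u + 1 - 2 * of_nat e) * Z * (Z + 1) =
             4 * \<beta> * (q k * X - r k * (Z + 1))"
      using mellin_certificate[of "of_nat e" l \<beta> "u + \<beta>" u A "of_nat m" B "of_nat k"] e l
      unfolding A_def B_def X_def Y_def Z_def q_def r_def by fastforce
    also have "T k u * Y / (u * Z * (Z + 1)) * (4 * \<beta> * (q k * X - r k * (Z + 1))) = H k - G k"
      unfolding H_def G_def Z_def[symmetric] X_def[symmetric]
    proof -
      have Z': "u + \<beta> + of_nat (Suc k) = Z + 1" by (simp add: Z_def algebra_simps)
      show "T k u * Y / (u * Z * (Z + 1)) * (4 * \<beta> * (q k * X - r k * (Z + 1))) =
            4 * \<beta> / u * Y * (T k u * q k * X / Z) / (u + \<beta> + of_nat (Suc k)) -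
            4 * \<beta> / u * Y * (T k u * r k) / Z"
        unfolding Z' using u0 Z0 by (simp add: divide_simps) (simp add: algebra_simps)
    qed
    finally show ?thesis .
  qed
  \<comment> \<open>Here the recurrence for the coefficients enters.\<close>
  have GH: "G (Suc k) = H k" if k: "k < m" for k
  proof -
    have r: "r (Suc k) = of_nat (Suc k) * (2 * of_nat k + 1 + 2 * of_nat e)"
      by (simp add: r_def algebra_simps)
    have "T (Suc k) u * r (Suc k) = T k u * q k * (u + of_nat k) / (u + \<beta> + of_nat k)"
      unfolding T_def r q_def using k b[of k] c[OF k] by (rule mellin_summand_Suc)
    thus ?thesis by (simp only: G_def H_def)
  qed
  \<comment> \<open>There is no lower boundary term: \<open>r 0\<close> is 0, hence so is
    \<open>G 0\<close>.\<close>
  have "(\<Sum>k\<le>K. E k) = H K" if "K \<le> m" for K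
    using that
  proof (induction K)
    case 0
    thus ?case using E[of 0] by (simp add: G_def r_def)
  next
    case (Suc K)
    thus ?case using E[of "Suc K"] GH[of K] by simp
  qed
  from this[of m] have "(\<Sum>k\<le>m. E k) = 0"
    by (simp add: H_def q_def)
  thus ?thesis
    by (simp add: E_def S_def T_def sum.distrib sum_subtractf sum_distrib_left)
qed

section \<open>The polynomial in u and its recurrence for every u\<close>

definition mellin_poly :: "nat \<Rightarrow> (nat \<Rightarrow> complex) \<Rightarrow> complex \<Rightarrow> complex poly" where
  "mellin_poly m c \<beta> =
     (\<Sum>k\<le>m. smult (c k) ((\<Prod>i<k. [:of_nat i, 1:]) * (\<Prod>i=k..<m. [:\<beta> + of_nat i, 1:])))"

lemma poly_mellin_poly: "poly (mellin_poly m c \<beta>) u = (\<Sum>k\<le>m. mellin_summand m c \<beta> k u)"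
  by (simp add: mellin_poly_def mellin_summand_def poly_sum poly_prod pochhammer_prod
        atLeast0LessThan algebra_simps)

text \<open>Telescoping divides by u + k and u + \<beta> + k, so it applies only where these are
  nonzero. All positive integers u qualify because Re \<beta> > 0, and a polynomial with infinitely
  many roots is zero.\<close>

lemma mellin_poly_recurrence:
  fixes c :: "nat \<Rightarrow> complex" and \<beta> u l :: complex and m e :: nat
  assumes e: "e = 0 \<or> e = 1" and l: "l = 2 * \<beta> - 1 / 2" and \<beta>: "Re \<beta> > 0"
    and c: "\<And>k. k < m \<Longrightarrow> c (Suc k) * (of_nat (Suc k) * (2 * of_nat k + 1 + 2 * of_nat e)) =
                c k * (- 2 * (l + of_nat m + of_nat e + of_nat k) * (of_nat m - of_nat k))"
  defines "P \<equiv> mellin_poly m c \<beta>"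
  shows "2 * (u + 1) * (2 * l + 4 * of_nat m - 4 * u - 5 + 4 * of_nat e) * poly P (u + 2)
         - (8 * l * of_nat m + 2 * l + 8 * (of_nat m)\<^sup>2 - 16 * u\<^sup>2 - 24 * u - 11
                 + of_nat e * (4 * l + 8 * of_nat m + 16 * u + 10)) * poly P (u + 1)
         - 4 * (2 * u + 1 - 2 * of_nat e) * (u + \<beta> + of_nat m) * poly P u = 0"
    (is "?lhs u = 0")
proof -
  \<comment> \<open>The left-hand side as a polynomial in u; composition with
    \<open>[:2, 1:]\<close> and \<open>[:1, 1:]\<close> realises the shifts by 2 and 1.\<close>
  define Q where "Q = [:2, 2:] * [:2 * l + 4 * of_nat m - 5 + 4 * of_nat e, - 4:] * pcompose P [:2, 1:]
    - [:8 * l * of_nat m + 2 * l + 8 * (of_nat m)\<^sup>2 - 11 + of_nat e * (4 * l + 8 * of_nat m + 10),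
        16 * of_nat e - 24, - 16:] * pcompose P [:1, 1:]
    - [:4 * (1 - 2 * of_nat e), 8:] * [:\<beta> + of_nat m, 1:] * P"
  have Q: "poly Q v = ?lhs v" for v
    by (simp add: Q_def poly_pcompose add.commute) (simp add: algebra_simps power2_eq_square)
  have "poly Q (of_nat (Suc n)) = 0" for n
  proof -
    have "of_nat (Suc n) + of_nat k \<noteq> (0 :: complex)" "of_nat (Suc n) + \<beta> + of_nat k \<noteq> 0" for k
      using \<beta> by (auto simp: complex_eq_iff)
    from mellin_summand_telescope[OF e l c this] show ?thesis
      by (simp only: Q P_def poly_mellin_poly mult_minus_left add_uminus_conv_diff)
  qed
  hence "range (\<lambda>n. of_nat (Suc n)) \<subseteq> {v. poly Q v = 0}" by blast
  moreover have "infinite (range (\<lambda>n. of_nat (Suc n) :: complex))"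
    by (rule range_inj_infinite) (auto simp: inj_on_def)
  ultimately have "Q = 0"
    using poly_roots_finite finite_subset by blast
  thus ?thesis using Q[of u] by simp
qed

section \<open>Closed form and meromorphic continuation of the Mellin transform\<close>

lemma poly_analytic_on: "poly p analytic_on (A :: complex set)"
proof -
  have "(\<lambda>z. poly p z) holomorphic_on UNIV" by (intro holomorphic_intros)
  hence "poly p analytic_on UNIV" by (simp add: analytic_on_open)
  thus ?thesis by (rule analytic_on_subset) simp
qed

lemma parity_eps_eq: "parity_eps n = real (n mod 2)"
  by (cases "even n") (auto simp: parity_eps_def even_iff_mod_2_eq_zero odd_iff_mod_2_eq_one)

text \<open>The functional equation iterated; in terms of the entire function 1/Gamma it holds at
  every z.\<close>

lemma rGamma_conv_prod:
  fixes z :: complex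
  assumes "k \<le> m"
  shows "rGamma (z + of_nat k) = (\<Prod>i=k..<m. z + of_nat i) * rGamma (z + of_nat m)"
  using assms
proof (induction m rule: dec_induct)
  case (step m)
  thus ?case using rGamma_plus1[of "z + of_nat m"] by (simp add: add_ac mult_ac)
qed simp

text \<open>Only the numerator Gamma(u+k) requires u to avoid the poles; the denominator is handled
  by \<open>rGamma\<close>, which has none.\<close>

lemma Beta_conv_mellin_summand:
  assumes "k \<le> m" "u \<notin> \<int>\<^sub>\<le>\<^sub>0"
  shows "c k * Beta (u + of_nat k) \<beta> =
         Gamma \<beta> * Gamma u * rGamma (u + \<beta> + of_nat m) * mellin_summand m c \<beta> k u"
proof -
  have "Gamma (u + of_nat k) = pochhammer u k * Gamma u"
    using pochhammer_Gamma[of u k] assms(2) by (simp add: Gamma_eq_zero_iff)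
  moreover have "rGamma (u + of_nat k + \<beta>) = (\<Prod>i=k..<m. u + \<beta> + of_nat i) * rGamma (u + \<beta> + of_nat m)"
    using rGamma_conv_prod[OF assms(1), of "u + \<beta>"] by (simp add: add_ac)
  ultimately show ?thesis
    by (simp add: Beta_altdef mellin_summand_def)
qed

text \<open>The composition substitutes u = (s + e) / 2, and the factor \<open>fact n\<close>
  offsets the n! in the denominator of the formula.\<close>

definition gegenbauer_mellin_poly :: "nat \<Rightarrow> real \<Rightarrow> complex poly" where
  "gegenbauer_mellin_poly n l =
     smult (fact n)
       (pcompose (mellin_poly (n div 2) (\<lambda>k. of_real (gegenbauer_coeff (n div 2) (n mod 2) l k))
                    (of_real (l / 2 + 1 / 4)))
          [:of_nat (n mod 2) / 2, 1 / 2:])"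

text \<open>At a pole of the Gamma factor in the denominator, \<open>Gamma\<close> is 0 by
  convention and division by 0 gives 0, which is the correct value of 1/Gamma.\<close>

definition gegenbauer_mellin_formula :: "nat \<Rightarrow> real \<Rightarrow> complex \<Rightarrow> complex" where
  "gegenbauer_mellin_formula n l s =
     Gamma (of_real (l / 2 + 1 / 4)) * Gamma ((s + of_real (parity_eps n)) / 2) /
     (2 * fact n * Gamma ((s + of_nat n + of_real l) / 2 + 1 / 4)) * poly (gegenbauer_mellin_poly n l) s"

text \<open>Integrate term by term: the power x^(2k+e) shifts s to s + 2k + e, whose real part is
  positive, so each term is a Beta integral. Their common Gamma factors are then pulled out.\<close>

lemma has_integral_gegenbauer_mellin_integrand:
  assumes l: "l > - 1 / 2" and s: "Re s > - parity_eps n"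
  shows "(gegenbauer_mellin_integrand n l s has_integral gegenbauer_mellin_formula n l s) {0..1}"
proof -
  define m e where "m = n div 2" and "e = n mod 2"
  have n: "n = 2 * m + e" and e: "e \<le> 1" by (auto simp: m_def e_def)
  define \<beta> where "\<beta> = l / 2 + 1 / 4"
  have \<beta>: "\<beta> > 0" using l by (simp add: \<beta>_def)
  define c where "c = gegenbauer_coeff m e l"
  define u where "u = (s + of_nat e) / 2"
  have s': "Re s + real e > 0" using s by (simp add: parity_eps_eq e_def)
  have u: "u \<notin> \<int>\<^sub>\<le>\<^sub>0"
    using s' by (auto simp: u_def elim!: nonpos_Ints_cases dest!: arg_cong[where f = Re])
  define f where "f = (\<lambda>k x. complex_of_real (c k) *
      (of_real x powr (s + of_nat (2 * k + e) - 1) * of_real ((1 - x\<^sup>2) powr (\<beta> - 1))))"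
  have "(f k has_integral of_real (c k) * (Beta ((s + of_nat (2 * k + e)) / 2) (of_real \<beta>) / 2)) {0<..<1}" for k
    unfolding f_def using s' \<beta> by (intro has_integral_mult_right has_integral_Beta_squares) auto
  hence "((\<lambda>x. \<Sum>k\<le>m. f k x) has_integral
           (\<Sum>k\<le>m. of_real (c k) * (Beta ((s + of_nat (2 * k + e)) / 2) (of_real \<beta>) / 2))) {0<..<1}"
    by (intro has_integral_sum) auto
  also have "?this \<longleftrightarrow> (gegenbauer_mellin_integrand n l s has_integral
           (\<Sum>k\<le>m. of_real (c k) * (Beta ((s + of_nat (2 * k + e)) / 2) (of_real \<beta>) / 2))) {0<..<1}"
  proof (rule has_integral_cong)
    fix x :: real assume x: "x \<in> {0<..<1}"
    have "of_real x powr (s + of_nat j - 1) = of_real x ^ j * of_real x powr (s - 1)" for j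
      using x powr_add[of "complex_of_real x" "of_nat j" "s - 1"]
      by (simp add: powr_nat' add_ac diff_add_eq add_diff_eq)
    hence "f k x = of_real (c k * x ^ (2 * k + e)) * (of_real x powr (s - 1) * of_real ((1 - x\<^sup>2) powr (l / 2 - 3 / 4)))"
      for k unfolding f_def by (simp add: \<beta>_def del: of_nat_add)
    thus "(\<Sum>k\<le>m. f k x) = gegenbauer_mellin_integrand n l s x"
      unfolding gegenbauer_mellin_integrand_def n gegenbauer_conv_coeff[OF e] c_def
      by (simp add: sum_distrib_right mult.assoc)
  qed
  also have "(\<Sum>k\<le>m. of_real (c k) * (Beta ((s + of_nat (2 * k + e)) / 2) (of_real \<beta>) / 2)) =
             (\<Sum>k\<le>m. of_real (c k) * Beta (u + of_nat k) (of_real \<beta>)) / 2"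
    by (simp add: u_def sum_divide_distrib add_divide_distrib add_ac)
  also have "(\<Sum>k\<le>m. of_real (c k) * Beta (u + of_nat k) (of_real \<beta>)) =
             (\<Sum>k\<le>m. Gamma (of_real \<beta>) * Gamma u * rGamma (u + of_real \<beta> + of_nat m) *
                mellin_summand m (\<lambda>k. of_real (c k)) (of_real \<beta>) k u)"
    using u by (intro sum.cong refl Beta_conv_mellin_summand[where c = "\<lambda>k. of_real (c k)"]) auto
  also have "\<dots> / 2 = gegenbauer_mellin_formula n l s"
  proof -
    have 1: "(s + of_nat n + of_real l) / 2 + 1 / 4 = u + of_real \<beta> + of_nat m"
      by (simp add: n u_def \<beta>_def add_divide_distrib)
    have 2: "of_nat e / 2 + s * (1 / 2) = u"
      by (simp add: u_def add_divide_distrib)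
    have 3: "(s + of_real (parity_eps n)) / 2 = u"
      by (simp add: u_def parity_eps_eq e_def)
    have 4: "poly (gegenbauer_mellin_poly n l) s =
        fact n * (\<Sum>k\<le>m. mellin_summand m (\<lambda>k. of_real (c k)) (of_real \<beta>) k u)"
      unfolding gegenbauer_mellin_poly_def m_def[symmetric] e_def[symmetric] c_def[symmetric]
        \<beta>_def[symmetric] by (simp add: poly_pcompose poly_mellin_poly 2[simplified])
    show ?thesis
      unfolding gegenbauer_mellin_formula_def 1 3 4 \<beta>_def[symmetric] sum_distrib_left[symmetric]
      by (simp add: rGamma_inverse_Gamma divide_simps)
  qed
  finally show ?thesis by (simp add: has_integral_Icc_iff_Ioo)
qed

text \<open>In this form only the inverse of \<open>rGamma\<close> can be singular; the other
  factors are entire.\<close>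

lemma gegenbauer_mellin_formula_rGamma:
  "gegenbauer_mellin_formula n l = (\<lambda>s. Gamma (of_real (l / 2 + 1 / 4)) / (2 * fact n) *
     inverse (rGamma ((s + of_real (parity_eps n)) / 2)) *
     rGamma ((s + of_nat n + of_real l) / 2 + 1 / 4) * poly (gegenbauer_mellin_poly n l) s)"
  by (rule ext) (simp add: gegenbauer_mellin_formula_def rGamma_inverse_Gamma field_simps)

lemma gegenbauer_mellin_formula_analytic:
  assumes "(s + of_real (parity_eps n)) / 2 \<notin> \<int>\<^sub>\<le>\<^sub>0"
  shows "gegenbauer_mellin_formula n l analytic_on {s}"
  unfolding gegenbauer_mellin_formula_rGamma
  using assms by (intro analytic_intros poly_analytic_on) (auto simp: rGamma_eq_zero_iff)

lemma gegenbauer_mellin_formula_meromorphic: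
  "gegenbauer_mellin_formula n l meromorphic_on A"
  unfolding gegenbauer_mellin_formula_rGamma
  by (intro meromorphic_intros analytic_on_imp_meromorphic_on analytic_intros poly_analytic_on) auto

text \<open>A pole of the numerator may be cancelled by a zero of another factor;
  \<open>remove_sings\<close> then fills in the limit. It changes nothing on the half-plane of
  convergence, where the formula is analytic.\<close>

lemma is_gegenbauer_mellin_continuation_remove_sings:
  assumes "l > - 1 / 2"
  shows "is_gegenbauer_mellin_continuation n l (remove_sings (gegenbauer_mellin_formula n l))"
  unfolding is_gegenbauer_mellin_continuation_def
proof (intro conjI allI impI)
  show "remove_sings (gegenbauer_mellin_formula n l) nicely_meromorphic_on UNIV"
    by (intro remove_sings_nicely_meromorphic gegenbauer_mellin_formula_meromorphic)
  fix s assume s: "Re s > - parity_eps n"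
  hence "(s + of_real (parity_eps n)) / 2 \<notin> \<int>\<^sub>\<le>\<^sub>0"
    by (auto elim!: nonpos_Ints_cases dest!: arg_cong[where f = Re])
  thus "remove_sings (gegenbauer_mellin_formula n l) s =
        integral {0..1} (gegenbauer_mellin_integrand n l s)"
    using has_integral_gegenbauer_mellin_integrand[OF assms s]
    by (simp add: gegenbauer_mellin_formula_analytic integral_unique)
qed

text \<open>Both functions equal the integral on an open half-plane containing 1, so the uniqueness
  result for nicely meromorphic functions applies.\<close>

lemma is_gegenbauer_mellin_continuation_unique:
  assumes "is_gegenbauer_mellin_continuation n l F" "is_gegenbauer_mellin_continuation n l G"
  shows "F = G"
proof
  fix s
  have "eventually (\<lambda>z. z \<in> {z. Re z > - parity_eps n}) (at 1)"
    by (rule eventually_at_in_open') (auto simp: open_halfspace_Re_gt parity_eps_eq)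
  hence "eventually (\<lambda>z. F z = G z) (at 1)"
    by eventually_elim (use assms in \<open>auto simp: is_gegenbauer_mellin_continuation_def\<close>)
  hence "frequently (\<lambda>z. F z = G z) (at 1)"
    by (intro eventually_frequently) auto
  thus "F s = G s"
    using assms unfolding is_gegenbauer_mellin_continuation_def
    by (intro nicely_meromorphic_eqI[of F UNIV G 1]) auto
qed

lemma gegenbauer_mellin_eq:
  assumes "l > - 1 / 2"
  shows "gegenbauer_mellin n l = remove_sings (gegenbauer_mellin_formula n l)"
  unfolding gegenbauer_mellin_def
  using is_gegenbauer_mellin_continuation_remove_sings[OF assms] is_gegenbauer_mellin_continuation_unique
  by (intro the_equality) blast+

section \<open>The difference equations in s\<close>

text \<open>Shifting s by 2 and 4 shifts u by 1 and 2. Multiplying the recurrence in u by the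
  factorial of the degree gives both parities at once, with coefficients still written in u.\<close>

lemma gegenbauer_mellin_poly_recurrence:
  fixes s :: complex and l :: real and m e :: nat
  assumes e: "e = 0 \<or> e = 1" and l: "l > - 1 / 2"
  defines "u \<equiv> (s + of_nat e) / 2" and "P \<equiv> gegenbauer_mellin_poly (2 * m + e) l"
  shows "2 * (u + 1) * (2 * of_real l + 4 * of_nat m - 4 * u - 5 + 4 * of_nat e) * poly P (s + 4)
         - (8 * of_real l * of_nat m + 2 * of_real l + 8 * (of_nat m)\<^sup>2 - 16 * u\<^sup>2 - 24 * u - 11
                 + of_nat e * (4 * of_real l + 8 * of_nat m + 16 * u + 10)) * poly P (s + 2)
         - 4 * (2 * u + 1 - 2 * of_nat e) * (u + (of_real l / 2 + 1 / 4) + of_nat m) * poly P s = 0"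
proof -
  define \<beta> where "\<beta> = complex_of_real (l / 2 + 1 / 4)"
  define c where "c = (\<lambda>k. complex_of_real (gegenbauer_coeff m e l k))"
  define R where "R = mellin_poly m c \<beta>"
  have idx: "(2 * m + e) div 2 = m" "(2 * m + e) mod 2 = e" using e by auto
  have P: "poly P z = fact (2 * m + e) * poly R ((z + of_nat e) / 2)" for z
    unfolding P_def gegenbauer_mellin_poly_def idx R_def c_def \<beta>_def
    by (simp add: poly_pcompose add_divide_distrib add_ac)
  have arg: "(s + 4 + of_nat e) / 2 = u + 2" "(s + 2 + of_nat e) / 2 = u + 1"
    by (simp_all add: u_def field_simps)
  have "c (Suc k) * (of_nat (Suc k) * (2 * of_nat k + 1 + 2 * of_nat e)) =
        c k * (- 2 * (of_real l + of_nat m + of_nat e + of_nat k) * (of_nat m - of_nat k))"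
    if "k < m" for k
  proof -
    have "e \<le> 1" using e by auto
    from arg_cong[OF gegenbauer_coeff_Suc[OF this that, of l], of complex_of_real]
    show ?thesis by (simp add: c_def mult_ac)
  qed
  moreover have "complex_of_real l = 2 * \<beta> - 1 / 2" "Re \<beta> > 0"
    using l by (auto simp: \<beta>_def)
  ultimately have "2 * (u + 1) * (2 * of_real l + 4 * of_nat m - 4 * u - 5 + 4 * of_nat e) * poly R (u + 2)
         - (8 * of_real l * of_nat m + 2 * of_real l + 8 * (of_nat m)\<^sup>2 - 16 * u\<^sup>2 - 24 * u - 11
                 + of_nat e * (4 * of_real l + 8 * of_nat m + 16 * u + 10)) * poly R (u + 1)
         - 4 * (2 * u + 1 - 2 * of_nat e) * (u + \<beta> + of_nat m) * poly R u = 0"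
    unfolding R_def by (intro mellin_poly_recurrence e)
  from arg_cong[OF this, of "\<lambda>x. fact (2 * m + e) * x"] show ?thesis
    unfolding P arg u_def[symmetric] by (simp add: \<beta>_def right_diff_distrib mult_ac)
qed

theorem theorem4:
  fixes l :: real
  assumes "l > - 1 / 2" and "l \<noteq> 0"
  shows
    "(\<forall>n s. Re s > - parity_eps n \<longrightarrow> gegenbauer_mellin_integrand n l s integrable_on {0..1}) \<and>
     (\<forall>n. is_gegenbauer_mellin_continuation n l (gegenbauer_mellin n l)) \<and>
     (\<exists>p :: nat \<Rightarrow> complex poly.
        (\<forall>n s. (s + of_real (parity_eps n)) / 2 \<notin> \<int>\<^sub>\<le>\<^sub>0 \<longrightarrow>
           gegenbauer_mellin n l s =
             Gamma (of_real (l / 2 + 1 / 4)) * Gamma ((s + of_real (parity_eps n)) / 2) /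
             (2 * fact n * Gamma ((s + of_nat n + of_real l) / 2 + 1 / 4)) * poly (p n) s) \<and>
        (\<forall>n s.
           (s + 2) * (2 * of_real l + 4 * of_nat n - 2 * s - 5) * poly (p (2 * n)) (s + 4)
           - (8 * of_real l * of_nat n + 2 * of_real l + 8 * of_nat n ^ 2
                - 4 * s ^ 2 - 12 * s - 11) * poly (p (2 * n)) (s + 2)
           - (s + 1) * (2 * of_real l + 4 * of_nat n + 2 * s + 1) * poly (p (2 * n)) s = 0) \<and>
        (\<forall>n s.
           (s + 3) * (2 * of_real l + 4 * of_nat n - 2 * s - 3) * poly (p (2 * n + 1)) (s + 4)
           - (8 * of_real l * of_nat n + 6 * of_real l + 8 * of_nat n ^ 2 + 8 * of_nat n
                - 4 * s ^ 2 - 12 * s - 9) * poly (p (2 * n + 1)) (s + 2)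
           - s * (2 * of_real l + 4 * of_nat n + 2 * s + 3) * poly (p (2 * n + 1)) s = 0))"
proof (intro conjI allI impI exI[of _ "\<lambda>n. gegenbauer_mellin_poly n l"])
  fix n :: nat and s :: complex
  show "gegenbauer_mellin_integrand n l s integrable_on {0..1}" if "Re s > - parity_eps n"
    using has_integral_gegenbauer_mellin_integrand[OF assms(1) that] by blast
  show "is_gegenbauer_mellin_continuation n l (gegenbauer_mellin n l)"
    using is_gegenbauer_mellin_continuation_remove_sings[OF assms(1)]
    by (simp add: gegenbauer_mellin_eq[OF assms(1)])
  show "gegenbauer_mellin n l s =
          Gamma (of_real (l / 2 + 1 / 4)) * Gamma ((s + of_real (parity_eps n)) / 2) /
          (2 * fact n * Gamma ((s + of_nat n + of_real l) / 2 + 1 / 4)) * poly (gegenbauer_mellin_poly n l) s"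
    if "(s + of_real (parity_eps n)) / 2 \<notin> \<int>\<^sub>\<le>\<^sub>0"
    \<comment> \<open>Away from the poles of the numerator the formula is analytic, so
      \<open>remove_sings\<close> keeps its value.\<close>
    using gegenbauer_mellin_formula_analytic[OF that, of l]
    by (simp only: gegenbauer_mellin_eq[OF assms(1)] remove_sings_at_analytic gegenbauer_mellin_formula_def)
  show "(s + 2) * (2 * of_real l + 4 * of_nat n - 2 * s - 5) * poly (gegenbauer_mellin_poly (2 * n) l) (s + 4)
           - (8 * of_real l * of_nat n + 2 * of_real l + 8 * of_nat n ^ 2
                - 4 * s ^ 2 - 12 * s - 11) * poly (gegenbauer_mellin_poly (2 * n) l) (s + 2)
           - (s + 1) * (2 * of_real l + 4 * of_nat n + 2 * s + 1) * poly (gegenbauer_mellin_poly (2 * n) l) s = 0"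
  proof -
    \<comment> \<open>Even degree: e = 0 and u = s / 2 turn the three coefficients into the stated
      ones.\<close>
    have "2 * (s / 2 + 1) * (2 * of_real l + 4 * of_nat n - 4 * (s / 2) - 5) =
            (s + 2) * (2 * of_real l + 4 * of_nat n - 2 * s - 5)"
      and "8 * of_real l * of_nat n + 2 * of_real l + 8 * of_nat n ^ 2 - 16 * (s / 2) ^ 2 - 24 * (s / 2) - 11 =
            8 * of_real l * of_nat n + 2 * of_real l + 8 * of_nat n ^ 2 - 4 * s ^ 2 - 12 * s - 11"
      and "4 * (2 * (s / 2) + 1) * (s / 2 + (of_real l / 2 + 1 / 4) + of_nat n) =
            (s + 1) * (2 * of_real l + 4 * of_nat n + 2 * s + 1)"
      by (simp_all add: field_simps power2_eq_square)
    with gegenbauer_mellin_poly_recurrence[of 0 l s n] assms(1) show ?thesis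
      by (simp only: of_nat_0 mult_zero_left mult_zero_right add_0_right diff_zero simp_thms)
  qed
  show "(s + 3) * (2 * of_real l + 4 * of_nat n - 2 * s - 3) * poly (gegenbauer_mellin_poly (2 * n + 1) l) (s + 4)
           - (8 * of_real l * of_nat n + 6 * of_real l + 8 * of_nat n ^ 2 + 8 * of_nat n
                - 4 * s ^ 2 - 12 * s - 9) * poly (gegenbauer_mellin_poly (2 * n + 1) l) (s + 2)
           - s * (2 * of_real l + 4 * of_nat n + 2 * s + 3) * poly (gegenbauer_mellin_poly (2 * n + 1) l) s = 0"
  proof -
    \<comment> \<open>Odd degree: e = 1, so the coefficients are compared after inserting s = 2u -
      1.\<close>
    define u where "u = (s + 1) / 2"
    have s: "s = 2 * u - 1" by (simp add: u_def field_simps)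
    have "2 * (u + 1) * (2 * of_real l + 4 * of_nat n - 4 * u - 5 + 4) =
            (s + 3) * (2 * of_real l + 4 * of_nat n - 2 * s - 3)"
      and "8 * of_real l * of_nat n + 2 * of_real l + 8 * of_nat n ^ 2 - 16 * u ^ 2 - 24 * u - 11
             + (4 * of_real l + 8 * of_nat n + 16 * u + 10) =
            8 * of_real l * of_nat n + 6 * of_real l + 8 * of_nat n ^ 2 + 8 * of_nat n - 4 * s ^ 2 - 12 * s - 9"
      and "4 * (2 * u + 1 - 2) * (u + (of_real l / 2 + 1 / 4) + of_nat n) =
            s * (2 * of_real l + 4 * of_nat n + 2 * s + 3)"
      by (simp_all add: s field_simps power2_eq_square)
    with gegenbauer_mellin_poly_recurrence[of 1 l s n] assms(1) show ?thesis
      by (simp only: u_def of_nat_1 mult_1 mult_1_right simp_thms)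
  qed
qed

end
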